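(* Let $p<q$ be square-free integers $\ge 2$ with $p\equiv 2\pmod 4$ and $q\equiv 3\pmod 4$, put $r=pq/\gcd(p,q)^2$ and assume $p<q<r$. Let $K=\mathbb{Q}(\sqrt p,\sqrt q)$. Let $m$ be a positive integer with $m<\frac{r}{16\kappa\lceil\sqrt r\rceil}$ for some positive integer $\kappa$. Put $$N_1=\max\{\lceil 2\sqrt q-\sqrt p\rceil,\ \lceil\sqrt r-\sqrt p\rceil\}-\sqrt p,\qquad N_2=\max\{\lceil 2\sqrt p-\sqrt q\rceil,\ \lceil\sqrt r-\sqrt q\rceil\}-\sqrt q .$$ If $p\ge\left(m+\sqrt{2mN_1}\right)^2$ and $q\ge\left(m+\sqrt{2mN_2}\right)^2$, then not all elements of $m\mathcal{O}_K^+$ are sums of squares of elements of $\mathcal{O}_K$.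
   Context: $\mathcal{O}_K$ is the ring of integers of $K$, $\mathcal{O}_K^+$ is the set of its totally positive elements (all four real embeddings positive), and $m\mathcal{O}_K^+=\{m\alpha:\alpha\in\mathcal{O}_K^+\}$. A sum of squares in $\mathcal{O}_K$ is a finite sum $\sum_i\alpha_i^2$ with $\alpha_i\in\mathcal{O}_K$. The square roots in the hypotheses are real square roots, so the hypotheses presuppose $N_1,N_2\ge 0$. *)

theory Defs
  imports Complex_Main "HOL-Computational_Algebra.Computational_Algebra"
begin

text \<open>The subfield generated by a set; in characteristic zero it contains the rationals,
  so over the reals this is the field obtained by adjoining \<open>S\<close> to the rational numbers.\<close>

inductive_set gen_subfield :: "'a::field set \<Rightarrow> 'a set" for S :: "'a set" where
  gen: "x \<in> S \<Longrightarrow> x \<in> gen_subfield S"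
| one: "1 \<in> gen_subfield S"
| add: "x \<in> gen_subfield S \<Longrightarrow> y \<in> gen_subfield S \<Longrightarrow> x + y \<in> gen_subfield S"
| uminus: "x \<in> gen_subfield S \<Longrightarrow> - x \<in> gen_subfield S"
| mult: "x \<in> gen_subfield S \<Longrightarrow> y \<in> gen_subfield S \<Longrightarrow> x * y \<in> gen_subfield S"
| inverse: "x \<in> gen_subfield S \<Longrightarrow> inverse x \<in> gen_subfield S"

definition biquadratic_field :: "nat \<Rightarrow> nat \<Rightarrow> real set" where
  "biquadratic_field p q = gen_subfield {sqrt (real p), sqrt (real q)}"

definition ring_of_integers :: "'a::field_char_0 set \<Rightarrow> 'a set" where
  "ring_of_integers K = {x \<in> K. algebraic_int x}"

text \<open>A real embedding is a unital ring homomorphism from \<open>K\<close> to the reals, represented by a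
  total function of which only the values on \<open>K\<close> matter.\<close>

definition real_embedding :: "'a::field set \<Rightarrow> ('a \<Rightarrow> real) \<Rightarrow> bool" where
  "real_embedding K \<sigma> \<longleftrightarrow> \<sigma> 1 = 1 \<and>
     (\<forall>x\<in>K. \<forall>y\<in>K. \<sigma> (x + y) = \<sigma> x + \<sigma> y \<and> \<sigma> (x * y) = \<sigma> x * \<sigma> y)"

text \<open>This is the usual notion for totally real \<open>K\<close>, where every complex embedding is real.\<close>

definition totally_positive :: "'a::field set \<Rightarrow> 'a \<Rightarrow> bool" where
  "totally_positive K x \<longleftrightarrow> (\<forall>\<sigma>. real_embedding K \<sigma> \<longrightarrow> \<sigma> x > 0)"

definition totally_positive_integers :: "'a::field_char_0 set \<Rightarrow> 'a set" where
  "totally_positive_integers K = {x \<in> ring_of_integers K. totally_positive K x}"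

definition sums_of_squares :: "'a::comm_ring_1 set \<Rightarrow> 'a set" where
  "sums_of_squares R = {\<Sum>x\<leftarrow>xs. x\<^sup>2 | xs. set xs \<subseteq> R}"

end

theory Submission
  imports Defs "Jordan_Normal_Form.Char_Poly"
begin

text \<open>Let \<open>A\<close> be the maximum occurring in \<open>N\<^sub>1\<close>. The totally positive integer \<open>A + \<surd>p\<close> is a
  counterexample: \<open>m (A + \<surd>p)\<close> is not a sum of squares. Write an integer of \<open>K\<close> as
  \<open>a + b\<surd>p + c\<surd>q + d\<surd>r\<close> with rational coordinates. Relative traces and norms show that \<open>2d\<close> is an
  integer, and that \<open>b\<close> is an integer if \<open>d = 0\<close>. The rational part of \<open>\<Sum>x\<^sub>i\<^sup>2\<close> is
  \<open>\<Sum>(a\<^sub>i\<^sup>2 + p b\<^sub>i\<^sup>2 + q c\<^sub>i\<^sup>2 + r d\<^sub>i\<^sup>2) = mA < r/4\<close>, so all \<open>d\<^sub>i\<close> vanish. Comparing coefficients of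
  \<open>\<surd>p\<close> gives \<open>2\<Sum>a\<^sub>i b\<^sub>i = m\<close> with integers \<open>b\<^sub>i\<close>, whence \<open>mA \<ge> p + m\<^sup>2/4\<close>. On the other hand the
  hypothesis on \<open>p\<close> says that \<open>m\<^sup>2 \<le> p\<close> and \<open>2mA \<le> p + m\<^sup>2\<close>, a contradiction.\<close>

section \<open>Sums and products of algebraic integers\<close>

text \<open>For finite \<open>S\<close> this is the finitely generated Z-module on which integrality
  is tested. For infinite \<open>S\<close> the convention for \<open>sum\<close> makes it the zero
  module.\<close>

definition int_span :: "'a::field_char_0 set \<Rightarrow> 'a set" where
  "int_span S = range (\<lambda>c. \<Sum>s\<in>S. of_int (c s) * s)"

lemma int_spanI: "x = (\<Sum>s\<in>S. of_int (c s) * s) \<Longrightarrow> x \<in> int_span S"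
  by (auto simp: int_span_def)

lemma int_span_superset:
  assumes "finite S" "s \<in> S"
  shows "s \<in> int_span S"
proof -
  have "s = (\<Sum>t\<in>S. of_int (if t = s then 1 else 0) * t)"
    using assms by (simp add: if_distrib[of of_int] if_distrib[of "\<lambda>x. x * _"] sum.delta cong: if_cong)
  then show ?thesis by (rule int_spanI)
qed

lemma int_span_zero: "0 \<in> int_span S"
  by (rule int_spanI[where c = "\<lambda>_. 0"]) simp

lemma int_span_add:
  assumes "x \<in> int_span S" "y \<in> int_span S"
  shows "x + y \<in> int_span S"
proof -
  obtain c c' where "x = (\<Sum>s\<in>S. of_int (c s) * s)" "y = (\<Sum>s\<in>S. of_int (c' s) * s)"
    using assms by (auto simp: int_span_def)
  then have "x + y = (\<Sum>s\<in>S. of_int (c s + c' s) * s)"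
    by (simp add: sum.distrib algebra_simps)
  then show ?thesis by (rule int_spanI)
qed

lemma int_span_scale:
  assumes "x \<in> int_span S"
  shows "of_int k * x \<in> int_span S"
proof -
  obtain c where "x = (\<Sum>s\<in>S. of_int (c s) * s)"
    using assms by (auto simp: int_span_def)
  then have "of_int k * x = (\<Sum>s\<in>S. of_int (k * c s) * s)"
    by (simp add: sum_distrib_left mult.assoc)
  then show ?thesis by (rule int_spanI)
qed

lemma int_span_sum: "(\<And>i. i \<in> I \<Longrightarrow> f i \<in> int_span S) \<Longrightarrow> sum f I \<in> int_span S"
  by (induction I rule: infinite_finite_induct) (auto intro: int_span_zero int_span_add)

text \<open>Multiplication by \<open>x\<close> is additive, so stability needs checking on
  generators only; this allows two multiplications to be composed.\<close>

lemma int_span_mult_closed: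
  assumes "\<And>s. s \<in> S \<Longrightarrow> x * s \<in> int_span S" "t \<in> int_span S"
  shows "x * t \<in> int_span S"
proof -
  obtain c where "t = (\<Sum>s\<in>S. of_int (c s) * s)"
    using assms(2) by (auto simp: int_span_def)
  then have "x * t = (\<Sum>s\<in>S. of_int (c s) * (x * s))"
    by (simp add: sum_distrib_left algebra_simps)
  also have "\<dots> \<in> int_span S" by (intro int_span_sum int_span_scale assms(1))
  finally show ?thesis .
qed

text \<open>The vector of generators is an eigenvector, with eigenvalue \<open>z\<close>, of an integer matrix.\<close>

lemma algebraic_int_if_stabilizes_int_span:
  assumes fin: "finite S" and nz: "s0 \<in> S" "s0 \<noteq> 0"
    and stab: "\<And>s. s \<in> S \<Longrightarrow> z * s \<in> int_span S"
  shows "algebraic_int z"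
proof -
  have "\<forall>s\<in>S. \<exists>c. z * s = (\<Sum>t\<in>S. of_int (c t) * t)"
    using stab by (auto simp: int_span_def)
  then obtain c where c: "\<And>s. s \<in> S \<Longrightarrow> z * s = (\<Sum>t\<in>S. of_int (c s t) * t)"
    by metis
  obtain f where f: "bij_betw f {0..<card S} S"
    using ex_bij_betw_nat_finite[OF fin] by blast
  define n where "n = card S"
  define A :: "int mat" where "A = mat n n (\<lambda>(i, j). c (f i) (f j))"
  define B :: "'a mat" where "B = map_mat of_int A"
  define v where "v = vec n f"
  have A: "A \<in> carrier_mat n n" and B: "B \<in> carrier_mat n n" by (auto simp: A_def B_def)
  have "v \<noteq> 0\<^sub>v n"
  proof
    assume *: "v = 0\<^sub>v n"
    have "s0 \<in> f ` {0..<n}" using f nz(1) unfolding bij_betw_def n_def by simp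
    then obtain i where "i < n" "f i = s0" by auto
    then show False using arg_cong[OF *, of "\<lambda>v. vec_index v i"] nz(2) by (simp add: v_def)
  qed
  moreover have "B *\<^sub>v v = z \<cdot>\<^sub>v v"
  proof (rule eq_vecI)
    fix i assume "i < dim_vec (z \<cdot>\<^sub>v v)"
    then have i: "i < n" by (simp add: v_def)
    then have "f i \<in> S" using f unfolding bij_betw_def n_def by auto
    then have "z * f i = (\<Sum>t\<in>S. of_int (c (f i) t) * t)" by (rule c)
    also have "\<dots> = (\<Sum>j=0..<n. of_int (c (f i) (f j)) * f j)"
      using sum.reindex_bij_betw[OF f, of "\<lambda>t. of_int (c (f i) t) * t"] by (simp add: n_def)
    finally show "vec_index (B *\<^sub>v v) i = vec_index (z \<cdot>\<^sub>v v) i"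
      using i by (simp add: B_def A_def v_def scalar_prod_def)
  qed (simp add: B_def A_def v_def)
  ultimately have "eigenvalue B z"
    using B unfolding eigenvalue_def eigenvector_def by (intro exI[of _ v]) (auto simp: v_def)
  then have root: "poly (char_poly B) z = 0" using eigenvalue_root_char_poly[OF B] by simp
  have "char_poly B = map_poly of_int (char_poly A)"
    unfolding B_def by (rule of_int_hom.char_poly_hom[OF A])
  then have "\<forall>i. coeff (char_poly B) i \<in> \<int>" by (simp add: coeff_map_poly)
  moreover have "lead_coeff (char_poly B) = 1" using degree_monic_char_poly[OF B] by simp
  ultimately show ?thesis using root by (intro algebraic_int.intros)
qed

section \<open>Reduction of powers and the ring generated by two algebraic integers\<close>

lemma algebraic_int_power_reduction:
  assumes "algebraic_int x"
  obtains d c where "d > 0" "x ^ d = (\<Sum>i<d. of_int (c i) * x ^ i)"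
proof -
  from assms obtain P where P: "poly P x = 0" "lead_coeff P = 1" "\<forall>i. coeff P i \<in> \<int>"
    by (auto elim: algebraic_int.cases)
  \<comment> \<open>A monic constant is 1 and has no root. Positivity of the degree later places 1
    among the monomials.\<close>
  have "degree P > 0"
  proof (rule ccontr)
    assume "\<not> degree P > 0"
    then obtain a where "P = [:a:]" by (auto elim: degree_eq_zeroE)
    then show False using P by simp
  qed
  moreover from P(3) obtain c where c: "\<And>i. coeff P i = of_int (c i)"
    unfolding Ints_def image_iff by metis
  have "x ^ degree P = (\<Sum>i<degree P. of_int (- c i) * x ^ i)"
    using P(1,2) by (simp add: poly_altdef lessThan_Suc_atMost[symmetric] c sum_negf eq_neg_iff_add_eq_0 add.commute)
  ultimately show ?thesis by (rule that)
qed

text \<open>Once \<open>x ^ d\<close> and \<open>y ^ e\<close> reduce to integer combinations of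
  lower powers, these monomials generate the ring Z[x, y] as an additive group.\<close>

definition monomials :: "'a::field_char_0 \<Rightarrow> nat \<Rightarrow> 'a \<Rightarrow> nat \<Rightarrow> 'a set" where
  "monomials x d y e = (\<lambda>(i, j). x ^ i * y ^ j) ` ({..<d} \<times> {..<e})"

lemma finite_monomials: "finite (monomials x d y e)"
  by (simp add: monomials_def)

lemma monomials_commute: "monomials x d y e = monomials y e x d"
  unfolding monomials_def by (auto simp: image_iff mult.commute)

text \<open>Only a monomial with exponent \<open>d - 1\<close> of \<open>x\<close> leaves the list,
  and the relation for \<open>x ^ d\<close> brings it back.\<close>

lemma mult_monomials_in_int_span:
  assumes x: "x ^ d = (\<Sum>i<d. of_int (c i) * x ^ i)" and s: "s \<in> monomials x d y e"
  shows "x * s \<in> int_span (monomials x d y e)"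
proof -
  obtain i j where ij: "i < d" "j < e" "s = x ^ i * y ^ j"
    using s by (auto simp: monomials_def)
  have gen: "x ^ k * y ^ j \<in> int_span (monomials x d y e)" if "k < d" for k
    using that ij(2) by (intro int_span_superset finite_monomials) (auto simp: monomials_def)
  have xs: "x * s = x ^ Suc i * y ^ j" using ij by simp
  show ?thesis
  proof (cases "Suc i < d")
    case True
    then show ?thesis unfolding xs by (rule gen)
  next
    case False
    then have "Suc i = d" using ij by simp
    then have "x * s = (\<Sum>k<d. of_int (c k) * (x ^ k * y ^ j))"
      unfolding xs by (simp only: x) (simp add: sum_distrib_right mult.assoc)
    also have "\<dots> \<in> int_span (monomials x d y e)"
      by (intro int_span_sum int_span_scale gen) simp
    finally show ?thesis .
  qed
qed

text \<open>Multiplication by \<open>x\<close> and by \<open>y\<close> maps the span of the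
  monomials into itself, hence so do their sum and their composite; 1 is the nonzero generator
  required by the eigenvector criterion.\<close>

lemma
  fixes x y :: "'a::field_char_0"
  assumes "algebraic_int x" "algebraic_int y"
  shows algebraic_int_plus: "algebraic_int (x + y)"
    and algebraic_int_times: "algebraic_int (x * y)"
proof -
  obtain d c where d: "d > 0" "x ^ d = (\<Sum>i<d. of_int (c i) * x ^ i)"
    using algebraic_int_power_reduction[OF assms(1)] .
  obtain e c' where e: "e > 0" "y ^ e = (\<Sum>i<e. of_int (c' i) * y ^ i)"
    using algebraic_int_power_reduction[OF assms(2)] .
  define S where "S = monomials x d y e"
  have x: "x * s \<in> int_span S" if "s \<in> S" for s
    using mult_monomials_in_int_span[OF d(2)] that unfolding S_def .
  have y: "y * s \<in> int_span S" if "s \<in> S" for s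
    using mult_monomials_in_int_span[OF e(2)] that unfolding S_def monomials_commute[of x] .
  have one: "1 \<in> S" using d(1) e(1) by (force simp: S_def monomials_def image_iff)
  have fin: "finite S" by (simp add: S_def finite_monomials)
  show "algebraic_int (x + y)"
    by (rule algebraic_int_if_stabilizes_int_span[OF fin one])
       (auto simp: distrib_right intro: int_span_add x y)
  show "algebraic_int (x * y)"
    by (rule algebraic_int_if_stabilizes_int_span[OF fin one])
       (auto simp: mult.assoc intro: int_span_mult_closed x y)
qed

section \<open>Quadratic extensions of subfields\<close>

locale subfield_of =
  fixes F :: "'a::field_char_0 set"
  assumes one_mem: "1 \<in> F"
    and add_mem: "x \<in> F \<Longrightarrow> y \<in> F \<Longrightarrow> x + y \<in> F"
    and uminus_mem: "x \<in> F \<Longrightarrow> - x \<in> F"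
    and mult_mem: "x \<in> F \<Longrightarrow> y \<in> F \<Longrightarrow> x * y \<in> F"
    and inverse_mem: "x \<in> F \<Longrightarrow> inverse x \<in> F"
begin

lemma diff_mem: "x \<in> F \<Longrightarrow> y \<in> F \<Longrightarrow> x - y \<in> F"
  using add_mem[of x "- y"] uminus_mem[of y] by simp

lemma zero_mem: "0 \<in> F"
  using diff_mem[OF one_mem one_mem] by simp

lemma divide_mem: "x \<in> F \<Longrightarrow> y \<in> F \<Longrightarrow> x / y \<in> F"
  using mult_mem[of x "inverse y"] inverse_mem[of y] by (simp add: divide_inverse)

lemma of_nat_mem: "of_nat n \<in> F"
  by (induction n) (auto intro: zero_mem add_mem one_mem)

lemma of_int_mem: "of_int k \<in> F"
  by (cases k rule: int_cases2) (auto intro: of_nat_mem uminus_mem)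

lemmas mem_intros = zero_mem one_mem add_mem uminus_mem diff_mem mult_mem inverse_mem divide_mem
  of_nat_mem of_int_mem

end

lemma subfield_of_Rats: "subfield_of (\<rat> :: 'a::field_char_0 set)"
  by unfold_locales auto

lemma subfield_of_gen_subfield: "subfield_of (gen_subfield S)"
  by unfold_locales (auto intro: gen_subfield.intros)

definition adjoin :: "'a::field_char_0 set \<Rightarrow> 'a \<Rightarrow> 'a set" where
  "adjoin F s = {u + v * s | u v. u \<in> F \<and> v \<in> F}"

lemma adjoinI: "u \<in> F \<Longrightarrow> v \<in> F \<Longrightarrow> u + v * s \<in> adjoin F s"
  by (auto simp: adjoin_def)

text \<open>The degenerate case \<open>s \<in> F\<close> is still allowed, so that closure of
  \<open>adjoin F s\<close> can be proved before irrationality enters.\<close>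

locale quadratic_ext = subfield_of F for F :: "'a::field_char_0 set" +
  fixes s :: 'a
  assumes sq_mem: "s * s \<in> F"
begin

lemma subset_adjoin: "F \<subseteq> adjoin F s"
proof
  fix x assume "x \<in> F"
  then show "x \<in> adjoin F s" using adjoinI[of x F 0 s] zero_mem by simp
qed

lemma generator_mem_adjoin: "s \<in> adjoin F s"
  using adjoinI[of 0 F 1 s] zero_mem one_mem by simp

lemma adjoin_inverse:
  assumes "x \<in> adjoin F s"
  shows "inverse x \<in> adjoin F s"
proof -
  obtain u v where x: "x = u + v * s" and uv: "u \<in> F" "v \<in> F"
    using assms by (auto simp: adjoin_def)
  define n where "n = u * u - v * v * (s * s)"
  have nF: "n \<in> F" unfolding n_def by (intro mem_intros uv sq_mem)
  have fact: "n = (u + v * s) * (u - v * s)"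
    by (simp add: n_def algebra_simps)
  \<comment> \<open>The inverse is the conjugate divided by the norm \<open>n\<close>. In the
    degenerate case the norm of a nonzero \<open>x\<close> can vanish; then \<open>u = v * s\<close>
    and \<open>x = 2 * u\<close> lies in \<open>F\<close> already.\<close>
  show ?thesis
  proof (cases "n = 0")
    case True
    then have "u + v * s = 0 \<or> u - v * s = 0" using fact by simp
    then consider "x = 0" | "u = v * s" using x by force
    then show ?thesis
    proof cases
      case 1
      then show ?thesis using subset_adjoin zero_mem by auto
    next
      case 2
      then have "x = 2 * u" using x by simp
      then have "x \<in> F" using mult_mem[OF of_nat_mem[of 2] uv(1)] by simp
      then show ?thesis using inverse_mem subset_adjoin by blast
    qed
  next
    case False
    then have "x * ((u - v * s) / n) = 1" using fact x by simp
    then have "inverse x = (u - v * s) / n" by (rule inverse_unique)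
    then have "inverse x = u / n + (- v / n) * s" by (simp add: diff_divide_distrib)
    moreover have "u / n \<in> F" "- v / n \<in> F" by (intro mem_intros uv nF)+
    ultimately show ?thesis by (simp only: adjoinI)
  qed
qed

lemma subfield_adjoin: "subfield_of (adjoin F s)"
proof
  show "1 \<in> adjoin F s" using subset_adjoin one_mem by blast
next
  fix x y assume "x \<in> adjoin F s" "y \<in> adjoin F s"
  then obtain u v u' v' where x: "x = u + v * s" "y = u' + v' * s"
    and uv: "u \<in> F" "v \<in> F" "u' \<in> F" "v' \<in> F"
    by (auto simp: adjoin_def)
  have "x + y = (u + u') + (v + v') * s" using x by (simp add: algebra_simps)
  then show "x + y \<in> adjoin F s" using uv by (simp only: adjoinI mem_intros)
  have "x * y = (u * u' + v * v' * (s * s)) + (u * v' + v * u') * s"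
    using x by (simp add: algebra_simps)
  then show "x * y \<in> adjoin F s" using uv by (simp only: adjoinI mem_intros sq_mem)
next
  fix x assume "x \<in> adjoin F s"
  then obtain u v where x: "x = u + v * s" and uv: "u \<in> F" "v \<in> F"
    by (auto simp: adjoin_def)
  have "- x = - u + (- v) * s" using x by simp
  then show "- x \<in> adjoin F s" using uv by (simp only: adjoinI mem_intros)
qed (rule adjoin_inverse)

end

section \<open>Conjugation, trace and norm relative to a subfield\<close>

locale proper_quadratic_ext = quadratic_ext +
  assumes not_mem: "s \<notin> F"
begin

text \<open>Linear independence of 1 and \<open>s\<close> over \<open>F\<close>: a relation with
  \<open>v \<noteq> 0\<close> would give \<open>s = - u / v\<close>, an element of
  \<open>F\<close>.\<close>

lemma eq_zero_iff:
  assumes "u \<in> F" "v \<in> F"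
  shows "u + v * s = 0 \<longleftrightarrow> u = 0 \<and> v = 0"
proof -
  have "v = 0" if "u + v * s = 0"
  proof (rule ccontr)
    assume "v \<noteq> 0"
    have "v * s = - u" using that by (metis add_eq_0_iff)
    then have "s = - u / v" using \<open>v \<noteq> 0\<close> by (simp add: field_simps)
    then show False using not_mem divide_mem[OF uminus_mem] assms by auto
  qed
  then show ?thesis by auto
qed

lemma eq_iff:
  assumes "u \<in> F" "v \<in> F" "u' \<in> F" "v' \<in> F"
  shows "u + v * s = u' + v' * s \<longleftrightarrow> u = u' \<and> v = v'"
  using eq_zero_iff[of "u - u'" "v - v'"] assms diff_mem by (auto simp: algebra_simps)

text \<open>Conjugation is a ring homomorphism fixing \<open>F\<close>, so it commutes with
  evaluation of polynomials over \<open>F\<close>. Horner's scheme proves this on pairs of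
  coordinates, without a conjugation map.\<close>

lemma poly_conjugate:
  assumes "u \<in> F" "v \<in> F" "\<And>i. coeff P i \<in> F"
  shows "\<exists>u'\<in>F. \<exists>v'\<in>F. poly P (u + v * s) = u' + v' * s \<and> poly P (u - v * s) = u' - v' * s"
  using assms(3)
proof (induction P)
  case 0
  then show ?case using zero_mem by (intro bexI[of _ 0]) auto
next
  case (pCons c P)
  have c: "c \<in> F" using pCons.prems[of 0] by simp
  have "coeff P i \<in> F" for i using pCons.prems[of "Suc i"] by simp
  then obtain u' v' where uv': "u' \<in> F" "v' \<in> F"
    "poly P (u + v * s) = u' + v' * s" "poly P (u - v * s) = u' - v' * s"
    using pCons.IH by blast
  have "c + (u * u' + v * v' * (s * s)) \<in> F" "u * v' + v * u' \<in> F"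
    using assms(1,2) uv'(1,2) c by (simp_all only: mem_intros sq_mem)
  moreover have
    "poly (pCons c P) (u + v * s) = (c + (u * u' + v * v' * (s * s))) + (u * v' + v * u') * s \<and>
     poly (pCons c P) (u - v * s) = (c + (u * u' + v * v' * (s * s))) - (u * v' + v * u') * s"
    by (simp only: poly_pCons uv') (simp add: algebra_simps)
  ultimately show ?case by blast
qed

text \<open>The conjugate is a root of the same monic integer polynomial: a zero value has both
  coordinates zero, hence so has its conjugate.\<close>

lemma algebraic_int_conjugate:
  assumes "u \<in> F" "v \<in> F" "algebraic_int (u + v * s)"
  shows "algebraic_int (u - v * s)"
proof -
  from assms(3) obtain P where P: "poly P (u + v * s) = 0" "lead_coeff P = 1" "\<forall>i. coeff P i \<in> \<int>"
    by (auto elim: algebraic_int.cases)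
  have "coeff P i \<in> F" for i
    using P(3)[THEN spec, of i] of_int_mem by (auto elim!: Ints_cases)
  from poly_conjugate[OF assms(1,2) this] obtain u' v'
    where uv': "u' \<in> F" "v' \<in> F" "poly P (u + v * s) = u' + v' * s"
      "poly P (u - v * s) = u' - v' * s" by blast
  then have "poly P (u - v * s) = 0" using P(1) eq_zero_iff by auto
  then show ?thesis using P by (auto intro: algebraic_int.intros)
qed

lemma algebraic_int_trace:
  assumes "u \<in> F" "v \<in> F" "algebraic_int (u + v * s)"
  shows "algebraic_int (2 * u)"
  using algebraic_int_plus[OF assms(3) algebraic_int_conjugate[OF assms]] by simp

lemma algebraic_int_norm:
  assumes "u \<in> F" "v \<in> F" "algebraic_int (u + v * s)"
  shows "algebraic_int (u * u - v * v * (s * s))"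
  using algebraic_int_times[OF assms(3) algebraic_int_conjugate[OF assms]]
  by (simp add: algebra_simps)

end

section \<open>Quadratic irrationalities\<close>

text \<open>With \<open>w = a / b\<close> in lowest terms, \<open>b^2\<close> divides
  \<open>D a^2\<close> and is coprime to \<open>a^2\<close>, so it divides the square-free
  \<open>D\<close>, which forces \<open>b = 1\<close>.\<close>

lemma squarefree_mult_square_int_imp_int:
  fixes w :: real
  assumes "squarefree D" "w \<in> \<rat>" "real D * w\<^sup>2 \<in> \<int>"
  shows "w \<in> \<int>"
proof -
  obtain a b where w: "w = of_int a / of_int b" and b: "b > 0" and ab: "coprime a b"
    using assms(2) by (auto elim!: Rats_cases')
  from assms(3) obtain k where "real D * w\<^sup>2 = of_int k" by (auto elim!: Ints_cases)
  then have "real_of_int (int D * a\<^sup>2) = of_int (k * b\<^sup>2)"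
    using b by (simp add: w field_simps)
  then have "int D * a\<^sup>2 = k * b\<^sup>2" by linarith
  then have "b\<^sup>2 dvd a\<^sup>2 * int D" by (simp add: mult.commute)
  moreover have "coprime (b\<^sup>2) (a\<^sup>2)" using ab by (simp add: coprime_commute)
  ultimately have "b\<^sup>2 dvd int D" by (simp add: coprime_dvd_mult_right_iff)
  then have "int ((nat b)\<^sup>2) dvd int D" using b by simp
  then have "(nat b)\<^sup>2 dvd D" by (simp only: int_dvd_int_iff)
  then have "nat b dvd 1" using assms(1) squarefreeD by blast
  then have "b = 1" using b by simp
  then show ?thesis by (simp add: w)
qed

lemma sqrt_squarefree_irrational:
  assumes "squarefree D" "D \<ge> 2"
  shows "sqrt (real D) \<notin> \<rat>"
proof
  assume *: "sqrt (real D) \<in> \<rat>"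
  \<comment> \<open>For \<open>w = sqrt D / D\<close> one has \<open>D w^2 = 1\<close>, yet
    \<open>w\<close> lies strictly between 0 and 1.\<close>
  have "sqrt (real D) / real D \<in> \<int>"
    by (rule squarefree_mult_square_int_imp_int[OF assms(1)])
       (use * assms(2) in \<open>auto simp: power_divide power2_eq_square\<close>)
  then obtain k where k: "sqrt (real D) / real D = of_int k" by (auto elim!: Ints_cases)
  have "sqrt (real D) < real D" using assms(2) by (simp add: real_sqrt_less_iff real_less_lsqrt power2_eq_square)
  then have "0 < sqrt (real D) / real D" "sqrt (real D) / real D < 1" using assms(2) by auto
  then show False unfolding k by simp
qed

text \<open>Squaring \<open>s = u + v * t\<close> makes \<open>t\<close> rational unless
  \<open>u * v = 0\<close>; but \<open>u = 0\<close> makes \<open>s * t\<close> rational, and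
  \<open>v = 0\<close> makes \<open>s\<close> rational.\<close>

lemma sqrt_not_mem_adjoin:
  fixes s t :: real
  assumes "s * s \<in> \<rat>" "t * t \<in> \<rat>" "s \<notin> \<rat>" "t \<notin> \<rat>" "s * t \<notin> \<rat>"
  shows "s \<notin> adjoin \<rat> t"
proof
  assume "s \<in> adjoin \<rat> t"
  then obtain u v where s: "s = u + v * t" and uv: "u \<in> \<rat>" "v \<in> \<rat>"
    by (auto simp: adjoin_def)
  have "u \<noteq> 0" using s assms(2,5) uv by (auto simp: mult.assoc)
  moreover have "v \<noteq> 0" using s assms(3) uv by auto
  ultimately have "t = (s * s - u * u - v * v * (t * t)) / (2 * u * v)"
    unfolding s by (simp add: field_simps)
  moreover have "\<dots> \<in> \<rat>" using assms(1,2) uv by simp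
  ultimately show False using assms(4) by simp
qed

lemma int_square_mod_4: "X\<^sup>2 mod 4 = (if even X then 0 else 1)" for X :: int
proof (cases "even X")
  case True
  then obtain k where "X = 2 * k" by (auto elim: evenE)
  then show ?thesis by simp
next
  case False
  then obtain k where k: "X = 2 * k + 1" by (auto elim: oddE)
  then have "X\<^sup>2 = 1 + 4 * (k * k + k)" by (simp add: power2_eq_square algebra_simps)
  then have "X\<^sup>2 mod 4 = 1 mod 4" by (simp only: mod_mult_self2)
  then show ?thesis using False by simp
qed

text \<open>Trace and norm give integers \<open>U = 2u\<close> and \<open>V = 2v\<close> with
  \<open>U^2 - D V^2\<close> divisible by 4. As squares are 0 or 1 modulo 4 and \<open>D\<close> is
  2 or 3, both \<open>U\<close> and \<open>V\<close> are even.\<close>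

lemma quadratic_integer_coords:
  fixes u v :: real
  assumes D: "squarefree D" "D \<ge> 2" "D mod 4 = 2 \<or> D mod 4 = 3"
    and uv: "u \<in> \<rat>" "v \<in> \<rat>" "algebraic_int (u + v * sqrt (real D))"
  shows "u \<in> \<int>" "v \<in> \<int>"
proof -
  interpret subfield_of "\<rat> :: real set" by (rule subfield_of_Rats)
  interpret proper_quadratic_ext "\<rat>" "sqrt (real D)"
    by unfold_locales (use sqrt_squarefree_irrational[OF D(1,2)] in auto)
  have "2 * u \<in> \<int>"
    using algebraic_int_trace[OF uv] uv by (intro rational_algebraic_int_is_int) auto
  then obtain U where U: "2 * u = of_int U" by (auto elim!: Ints_cases)
  have "u * u - v * v * (sqrt D * sqrt D) \<in> \<int>"
    using algebraic_int_norm[OF uv] uv by (intro rational_algebraic_int_is_int) auto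
  then obtain N where N: "u * u - v * v * real D = of_int N" by (auto elim!: Ints_cases)
  have "real D * (2 * v)\<^sup>2 = (2 * u)\<^sup>2 - 4 * (u * u - v * v * real D)"
    by (simp add: power2_eq_square algebra_simps)
  also have "\<dots> = of_int (U\<^sup>2 - 4 * N)" by (simp add: U N)
  finally have eq: "real D * (2 * v)\<^sup>2 = of_int (U\<^sup>2 - 4 * N)" .
  have "2 * v \<in> \<int>"
    by (rule squarefree_mult_square_int_imp_int[OF D(1)], use uv in simp, unfold eq) (rule Ints_of_int)
  then obtain V where V: "2 * v = of_int V" by (auto elim!: Ints_cases)
  have "real_of_int (int D * V\<^sup>2) = of_int (U\<^sup>2 - 4 * N)" using eq by (simp add: V)
  then have *: "int D * V\<^sup>2 = U\<^sup>2 - 4 * N" by linarith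
  define e where "e = int D div 4"
  have De: "int D = 4 * e + 2 \<or> int D = 4 * e + 3" using D(3) unfolding e_def by presburger
  have "even U \<and> even V"
  proof -
    have "(int D * V\<^sup>2 - U\<^sup>2) mod 4 = 0" using * by simp
    then have "((int D mod 4) * (V\<^sup>2 mod 4) mod 4 - U\<^sup>2 mod 4) mod 4 = 0"
      by (simp only: mod_mult_eq mod_diff_eq)
    moreover have "int D mod 4 = 2 \<or> int D mod 4 = 3" using De by auto
    ultimately show ?thesis by (auto simp: int_square_mod_4 split: if_splits)
  qed
  then obtain U' V' where "U = 2 * U'" "V = 2 * V'" by (auto elim!: evenE)
  then have "u = of_int U'" "v = of_int V'" using U V by auto
  then show "u \<in> \<int>" "v \<in> \<int>" by auto
qed

lemma nat_mult_irrational: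
  assumes "n > 0" "x \<notin> \<rat>"
  shows "real n * x \<notin> \<rat>"
proof
  assume "real n * x \<in> \<rat>"
  then have "real n * x / real n \<in> \<rat>" by (intro Rats_divide) auto
  then show False using assms by simp
qed

lemma proper_quadratic_ext_adjoin_Rats:
  fixes s t :: real
  assumes "s * s \<in> \<rat>" "t * t \<in> \<rat>" "s \<notin> \<rat>" "t \<notin> \<rat>" "s * t \<notin> \<rat>"
  shows "proper_quadratic_ext (adjoin \<rat> s) t"
proof -
  interpret subfield_of "\<rat> :: real set" by (rule subfield_of_Rats)
  interpret Q: quadratic_ext "\<rat>" s by unfold_locales (rule assms(1))
  interpret A: subfield_of "adjoin \<rat> s" by (rule Q.subfield_adjoin)
  show ?thesis
    by unfold_locales
       (use assms Q.subset_adjoin sqrt_not_mem_adjoin[of t s] in \<open>auto simp: mult.commute\<close>)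
qed

section \<open>Integers of the biquadratic field\<close>

text \<open>Coprimality of \<open>p0\<close> and \<open>q0\<close> makes \<open>g\<close> the gcd of
  \<open>p\<close> and \<open>q\<close>, so that \<open>r\<close> is
  \<open>p q / g^2\<close>.\<close>

locale biquadratic =
  fixes p q r g p0 q0 :: nat
  assumes p_eq: "p = g * p0" and q_eq: "q = g * q0" and r_eq: "r = p0 * q0"
    and squarefree_p: "squarefree p" and squarefree_q: "squarefree q"
    and coprime: "coprime p0 q0"
    and p_mod: "p mod 4 = 2" and q_mod: "q mod 4 = 3"
begin

lemma squarefree_r: "squarefree r"
  unfolding r_eq using squarefree_p squarefree_q coprime
  by (auto simp: p_eq q_eq intro!: squarefree_mult_coprime dest: squarefree_multD)

text \<open>Since \<open>q\<close> is odd, so are \<open>g\<close> and \<open>q0\<close>; hence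
  \<open>p0\<close> is 2 modulo 4, and so is \<open>p0 q0\<close>.\<close>

lemma r_mod: "r mod 4 = 2"
proof -
  have "(g mod 4) * (p0 mod 4) mod 4 = 2" "(g mod 4) * (q0 mod 4) mod 4 = 3"
    using p_mod q_mod by (simp_all add: p_eq q_eq mod_mult_eq)
  moreover have "x mod 4 \<in> {0, 1, 2, 3}" for x :: nat by auto
  note this[of g] this[of p0] this[of q0]
  ultimately have "(p0 mod 4) * (q0 mod 4) mod 4 = 2" by auto
  then show ?thesis by (simp add: r_eq mod_mult_eq)
qed

lemma ge_2: "p \<ge> 2" "q \<ge> 2" "r \<ge> 2"
proof -
  have "n \<ge> 2" if "n mod 4 = 2 \<or> n mod 4 = 3" for n :: nat
    using that by presburger
  then show "p \<ge> 2" "q \<ge> 2" "r \<ge> 2" using p_mod q_mod r_mod by auto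
qed

lemma factors_pos: "g > 0" "p0 > 0" "q0 > 0"
  using ge_2 by (auto simp: p_eq q_eq intro!: Nat.gr0I)

abbreviation "sp \<equiv> sqrt (real p)"
abbreviation "sq \<equiv> sqrt (real q)"
abbreviation "sr \<equiv> sqrt (real r)"
abbreviation "K \<equiv> biquadratic_field p q"

lemma sqrt_products: "sp * sq = real g * sr" "sp * sr = real p0 * sq" "sq * sr = real q0 * sp"
  by (simp_all add: p_eq q_eq r_eq real_sqrt_mult)

lemma irrational: "sp \<notin> \<rat>" "sq \<notin> \<rat>" "sr \<notin> \<rat>"
  using sqrt_squarefree_irrational squarefree_p squarefree_q squarefree_r ge_2 by auto

lemma products_irrational: "sp * sq \<notin> \<rat>" "sr * sp \<notin> \<rat>" "sq * sp \<notin> \<rat>"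
  using nat_mult_irrational[OF factors_pos(1) irrational(3)]
    nat_mult_irrational[OF factors_pos(2) irrational(2)] sqrt_products
  by (simp_all add: mult.commute)

text \<open>The biquadratic field is viewed over each of its three quadratic subfields, each of
  which supplies a relative trace.\<close>

sublocale PQ: proper_quadratic_ext "adjoin \<rat> sp" sq
  by (rule proper_quadratic_ext_adjoin_Rats) (use irrational products_irrational in auto)

sublocale RP: proper_quadratic_ext "adjoin \<rat> sr" sp
  by (rule proper_quadratic_ext_adjoin_Rats) (use irrational products_irrational in auto)

sublocale QP: proper_quadratic_ext "adjoin \<rat> sq" sp
  by (rule proper_quadratic_ext_adjoin_Rats) (use irrational products_irrational in auto)

sublocale P: proper_quadratic_ext \<rat> sp
proof -
  interpret subfield_of "\<rat> :: real set" by (rule subfield_of_Rats)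
  show "proper_quadratic_ext \<rat> sp" by unfold_locales (use irrational in auto)
qed

section \<open>Coordinates in the basis 1, sqrt p, sqrt q, sqrt r\<close>

definition comb :: "real \<Rightarrow> real \<Rightarrow> real \<Rightarrow> real \<Rightarrow> real" where
  "comb a b c d = a + b * sp + c * sq + d * sr"

text \<open>This and the next two regroupings use sqrt r = sqrt p sqrt q / g and sqrt q = sqrt p
  sqrt r / p0. In each, twice the first bracket is a relative trace.\<close>

lemma comb_eq_PQ: "comb a b c d = (a + b * sp) + (c + d / g * sp) * sq"
proof -
  have "d / g * (sp * sq) = d * sr" using factors_pos by (simp add: sqrt_products)
  then show ?thesis by (simp add: comb_def algebra_simps)
qed

lemma comb_eq_RP: "comb a b c d = (a + d * sr) + (b + c / p0 * sr) * sp"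
proof -
  have "c / p0 * (sp * sr) = c * sq" using factors_pos by (simp add: sqrt_products)
  then show ?thesis by (simp add: comb_def algebra_simps)
qed

lemma comb_eq_QP: "comb a b c d = (a + c * sq) + (b + d / g * sq) * sp"
proof -
  have "d / g * (sp * sq) = d * sr" using factors_pos by (simp add: sqrt_products)
  then show ?thesis by (simp add: comb_def algebra_simps)
qed

text \<open>Independence is applied twice, first over Q(sqrt p) and then over Q. The rational part
  and the coefficient of sqrt p are the two coordinates compared later.\<close>

lemma comb_inject:
  assumes "a \<in> \<rat>" "b \<in> \<rat>" "c \<in> \<rat>" "d \<in> \<rat>" "a' \<in> \<rat>" "b' \<in> \<rat>" "c' \<in> \<rat>" "d' \<in> \<rat>"
    and "comb a b c d = comb a' b' c' d'"
  shows "a = a'" "b = b'"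
proof -
  have "a + b * sp = a' + b' * sp"
    by (rule PQ.eq_iff[THEN iffD1, OF _ _ _ _ assms(9)[unfolded comb_eq_PQ], THEN conjunct1]; intro adjoinI)
       (use assms(1-8) in simp_all)
  then show "a = a'" "b = b'" using P.eq_iff assms(1-8) by blast+
qed

lemma comb_square:
  fixes a b c d :: real
  shows "(comb a b c d)\<^sup>2 = comb (a\<^sup>2 + p * b\<^sup>2 + q * c\<^sup>2 + r * d\<^sup>2) (2 * (a * b + q0 * c * d))
     (2 * (a * c + p0 * b * d)) (2 * (a * d + g * b * c))"
proof -
  have "(comb a b c d)\<^sup>2 = a\<^sup>2 + b\<^sup>2 * (sp * sp) + c\<^sup>2 * (sq * sq) + d\<^sup>2 * (sr * sr)
    + 2 * a * b * sp + 2 * a * c * sq + 2 * a * d * sr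
    + 2 * b * c * (sp * sq) + 2 * b * d * (sp * sr) + 2 * c * d * (sq * sr)"
    unfolding comb_def power2_eq_square by (simp add: algebra_simps del: real_sqrt_mult_self)
  also have "\<dots> = comb (a\<^sup>2 + p * b\<^sup>2 + q * c\<^sup>2 + r * d\<^sup>2) (2 * (a * b + q0 * c * d))
     (2 * (a * c + p0 * b * d)) (2 * (a * d + g * b * c))"
    unfolding sqrt_products comb_def by (simp add: algebra_simps)
  finally show ?thesis .
qed

lemma field_subset_adjoin: "K \<subseteq> adjoin (adjoin \<rat> sp) sq"
proof
  fix x assume "x \<in> K"
  interpret E: subfield_of "adjoin (adjoin \<rat> sp) sq" by (rule PQ.subfield_adjoin)
  from \<open>x \<in> K\<close> show "x \<in> adjoin (adjoin \<rat> sp) sq" unfolding biquadratic_field_def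
  proof induction
    case (gen x)
    then show ?case
      using PQ.generator_mem_adjoin PQ.subset_adjoin P.generator_mem_adjoin by auto
  qed (auto intro: E.mem_intros)
qed

lemma field_element_coords:
  assumes "x \<in> K"
  obtains a b c d where "a \<in> \<rat>" "b \<in> \<rat>" "c \<in> \<rat>" "d \<in> \<rat>" "x = comb a b c d"
proof -
  have "x \<in> adjoin (adjoin \<rat> sp) sq" using assms field_subset_adjoin by blast
  then obtain u v where u: "u \<in> adjoin \<rat> sp" and v: "v \<in> adjoin \<rat> sp" and x: "x = u + v * sq"
    unfolding adjoin_def[of "adjoin \<rat> sp"] by blast
  obtain a b where ab: "a \<in> \<rat>" "b \<in> \<rat>" "u = a + b * sp" using u unfolding adjoin_def by blast
  obtain c d where cd: "c \<in> \<rat>" "d \<in> \<rat>" "v = c + d * sp" using v unfolding adjoin_def by blast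
  \<comment> \<open>A coefficient \<open>d\<close> of sqrt p sqrt q becomes \<open>d * g\<close> at
    sqrt r.\<close>
  have "x = comb a b c (d * g)" using factors_pos by (simp add: comb_eq_PQ x ab cd)
  then show ?thesis using that[of a b c "d * g"] ab cd by simp
qed

text \<open>The three relative traces \<open>2a + 2b sqrt p\<close>, \<open>2a + 2c sqrt q\<close>
  and \<open>2a + 2d sqrt r\<close> are integers of quadratic fields whose radicands are 2 or 3
  modulo 4, so their coordinates are integers.\<close>

lemma integer_coords:
  assumes rat: "a \<in> \<rat>" "b \<in> \<rat>" "c \<in> \<rat>" "d \<in> \<rat>" and int: "algebraic_int (comb a b c d)"
  shows "2 * a \<in> \<int>" "2 * b \<in> \<int>" "2 * c \<in> \<int>" "2 * d \<in> \<int>"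
proof -
  have "algebraic_int (2 * (a + b * sp))"
    by (rule PQ.algebraic_int_trace[OF _ _ int[unfolded comb_eq_PQ]])
       (intro adjoinI; use rat in simp)+
  then have "algebraic_int (2 * a + 2 * b * sp)" by (simp add: algebra_simps)
  from quadratic_integer_coords[OF squarefree_p ge_2(1) _ _ _ this]
  show "2 * a \<in> \<int>" "2 * b \<in> \<int>" using rat p_mod by auto
  have "algebraic_int (2 * (a + c * sq))"
    by (rule QP.algebraic_int_trace[OF _ _ int[unfolded comb_eq_QP]])
       (intro adjoinI; use rat in simp)+
  then have "algebraic_int (2 * a + 2 * c * sq)" by (simp add: algebra_simps)
  from quadratic_integer_coords(2)[OF squarefree_q ge_2(2) _ _ _ this]
  show "2 * c \<in> \<int>" using rat q_mod by auto
  have "algebraic_int (2 * (a + d * sr))"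
    by (rule RP.algebraic_int_trace[OF _ _ int[unfolded comb_eq_RP]])
       (intro adjoinI; use rat in simp)+
  then have "algebraic_int (2 * a + 2 * d * sr)" by (simp add: algebra_simps)
  from quadratic_integer_coords(2)[OF squarefree_r ge_2(3) _ _ _ this]
  show "2 * d \<in> \<int>" using rat r_mod by auto
qed

text \<open>Traces leave a possible denominator 2 in \<open>b\<close>. The relative norm to Q(sqrt
  p), whose two coordinates are integers, removes it by a parity argument.\<close>

lemma integer_second_coord:
  assumes rat: "a \<in> \<rat>" "b \<in> \<rat>" "c \<in> \<rat>" and int: "algebraic_int (comb a b c 0)"
  shows "b \<in> \<int>"
proof -
  from integer_coords[OF rat _ int] obtain A B C
    where A: "2 * a = of_int A" and B: "2 * b = of_int B" and C: "2 * c = of_int C"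
    unfolding Ints_def by auto
  have "algebraic_int ((a + b * sp) + c * sq)" using int by (simp add: comb_def)
  then have "algebraic_int ((a + b * sp) * (a + b * sp) - c * c * (sq * sq))"
    using rat adjoinI[of c \<rat> 0 sp] by (intro PQ.algebraic_int_norm adjoinI) auto
  moreover have "(a + b * sp) * (a + b * sp) - c * c * (sq * sq)
      = (a\<^sup>2 + (sp * sp) * b\<^sup>2 - (sq * sq) * c\<^sup>2) + (2 * a * b) * sp"
    unfolding power2_eq_square by (simp only: algebra_simps)
  moreover have "\<dots> = (a\<^sup>2 + p * b\<^sup>2 - q * c\<^sup>2) + (2 * a * b) * sp" by simp
  ultimately have norm: "algebraic_int ((a\<^sup>2 + p * b\<^sup>2 - q * c\<^sup>2) + (2 * a * b) * sp)"
    by simp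
  have "a\<^sup>2 + p * b\<^sup>2 - q * c\<^sup>2 \<in> \<int>" "2 * a * b \<in> \<int>"
    using quadratic_integer_coords[OF squarefree_p ge_2(1) _ _ _ norm] rat p_mod by auto
  then obtain N k where N: "a\<^sup>2 + p * b\<^sup>2 - q * c\<^sup>2 = of_int N" and k: "2 * a * b = of_int k"
    unfolding Ints_def by auto
  have "real_of_int (A * B) = of_int (2 * k)"
    using k unfolding of_int_mult A[symmetric] B[symmetric] by simp
  then have AB: "A * B = 2 * k" by linarith
  have "real_of_int (A\<^sup>2 + int p * B\<^sup>2 - int q * C\<^sup>2) = (2 * a)\<^sup>2 + p * (2 * b)\<^sup>2 - q * (2 * c)\<^sup>2"
    by (simp add: A B C)
  also have "\<dots> = 4 * (a\<^sup>2 + p * b\<^sup>2 - q * c\<^sup>2)" by (simp add: power2_eq_square algebra_simps)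
  also have "\<dots> = of_int (4 * N)" by (simp add: N)
  finally have eq: "A\<^sup>2 + int p * B\<^sup>2 - int q * C\<^sup>2 = 4 * N" by linarith
  \<comment> \<open>If \<open>B\<close> is odd, then \<open>A\<close> is even because
    \<open>A * B = 2 * k\<close>, and the norm equation reads \<open>2 - 3 C^2 = 0\<close> modulo 4,
    impossible since \<open>C^2\<close> is 0 or 1.\<close>
  have "even B"
  proof (rule ccontr)
    assume "odd B"
    moreover have "even (A * B)" using AB by simp
    ultimately have "even A" by simp
    have "((A\<^sup>2 mod 4 + (int p mod 4) * (B\<^sup>2 mod 4) mod 4) mod 4 - (int q mod 4) * (C\<^sup>2 mod 4) mod 4) mod 4
        = (4 * N) mod 4"
      unfolding eq[symmetric] by (simp only: mod_mult_eq mod_add_eq mod_diff_eq)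
    moreover have "int p mod 4 = 2" "int q mod 4 = 3" using p_mod q_mod by presburger+
    ultimately show False
      using \<open>odd B\<close> \<open>even A\<close> by (auto simp: int_square_mod_4 split: if_splits)
  qed
  then obtain B' where "B = 2 * B'" by (auto elim: evenE)
  then have "b = of_int B'" using B by simp
  then show ?thesis by simp
qed

end

section \<open>Sums of squares\<close>

lemma member_le_sum_list_nonneg:
  fixes f :: "'b \<Rightarrow> 'a::ordered_comm_monoid_add"
  assumes "\<And>y. y \<in> set xs \<Longrightarrow> 0 \<le> f y" "x \<in> set xs"
  shows "f x \<le> (\<Sum>y\<leftarrow>xs. f y)"
  using assms
proof (induction xs)
  case (Cons z xs)
  have "0 \<le> (\<Sum>y\<leftarrow>xs. f y)" using Cons.prems(1) by (intro sum_list_nonneg) auto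
  then show ?case
    using Cons by (auto intro: add_increasing add_increasing2)
qed simp

text \<open>Expanding \<open>(a - M/2 b)^2 \<ge> 0\<close> bounds each summand below by
  \<open>M a b + (P - M^2/4) b^2\<close>; these bounds add up to
  \<open>M^2/2 + (P - M^2/4) \<Sum> b^2\<close>. Since \<open>M \<noteq> 0\<close>, some integer
  \<open>b\<close> is nonzero, so the sum of the \<open>b^2\<close> is at least 1. The single pair
  \<open>a = M/2\<close>, \<open>b = 1\<close> attains the bound.\<close>

lemma sum_list_weighted_squares_ge:
  fixes a b :: "'b \<Rightarrow> real"
  assumes int: "\<And>x. x \<in> set xs \<Longrightarrow> b x \<in> \<int>"
    and M: "(\<Sum>x\<leftarrow>xs. 2 * (a x * b x)) = M" "M \<noteq> 0" "M\<^sup>2 \<le> 4 * P"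
  shows "P + M\<^sup>2 / 4 \<le> (\<Sum>x\<leftarrow>xs. (a x)\<^sup>2 + P * (b x)\<^sup>2)"
proof -
  have "\<exists>x\<in>set xs. b x \<noteq> 0"
  proof (rule ccontr)
    assume "\<not> (\<exists>x\<in>set xs. b x \<noteq> 0)"
    then have "map (\<lambda>x. 2 * (a x * b x)) xs = map (\<lambda>x. 0) xs" by simp
    then have "M = (\<Sum>x\<leftarrow>xs. 0)" unfolding M(1)[symmetric] by (rule arg_cong)
    then show False using M(2) by simp
  qed
  then obtain y where y: "y \<in> set xs" "b y \<noteq> 0" by blast
  have "1 \<le> \<bar>b y\<bar>" using int[OF y(1)] y(2) by (rule Ints_nonzero_abs_ge1)
  then have "1 \<le> (b y)\<^sup>2" by (simp add: abs_square_le_1 one_le_power abs_le_square_iff[of 1, simplified])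
  also have "\<dots> \<le> (\<Sum>x\<leftarrow>xs. (b x)\<^sup>2)" by (rule member_le_sum_list_nonneg) (use y in auto)
  \<comment> \<open>The hypothesis \<open>M^2 \<le> 4 P\<close> makes the factor
    nonnegative.\<close>
  finally have "(P - M\<^sup>2 / 4) * 1 \<le> (P - M\<^sup>2 / 4) * (\<Sum>x\<leftarrow>xs. (b x)\<^sup>2)"
    using M(3) by (intro mult_left_mono) auto
  then have "P + M\<^sup>2 / 4 \<le> M / 2 * M + (P - M\<^sup>2 / 4) * (\<Sum>x\<leftarrow>xs. (b x)\<^sup>2)"
    by (simp add: power2_eq_square)
  also have "\<dots> = (\<Sum>x\<leftarrow>xs. M / 2 * (2 * (a x * b x)) + (P - M\<^sup>2 / 4) * (b x)\<^sup>2)"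
    by (simp add: sum_list_addf sum_list_const_mult flip: M(1))
  also have "\<dots> \<le> (\<Sum>x\<leftarrow>xs. (a x)\<^sup>2 + P * (b x)\<^sup>2)"
  proof (rule sum_list_mono)
    fix x
    have "0 \<le> (a x - M / 2 * b x)\<^sup>2" by simp
    then show "M / 2 * (2 * (a x * b x)) + (P - M\<^sup>2 / 4) * (b x)\<^sup>2 \<le> (a x)\<^sup>2 + P * (b x)\<^sup>2"
      by (simp add: power2_eq_square algebra_simps)
  qed
  finally show ?thesis .
qed

lemma sum_list_Rats: "(\<And>x. x \<in> set xs \<Longrightarrow> f x \<in> \<rat>) \<Longrightarrow> (\<Sum>x\<leftarrow>xs. f x) \<in> \<rat>"
  by (induction xs) auto

section \<open>Excluding \<open>m (A + sqrt p)\<close> as a sum of squares\<close>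

context biquadratic
begin

lemma sum_list_comb:
  "(\<Sum>x\<leftarrow>xs. comb (A x) (B x) (C x) (D x)) =
     comb (\<Sum>x\<leftarrow>xs. A x) (\<Sum>x\<leftarrow>xs. B x) (\<Sum>x\<leftarrow>xs. C x) (\<Sum>x\<leftarrow>xs. D x)"
  by (induction xs) (auto simp: comb_def algebra_simps)

lemma not_sum_of_squares:
  assumes m: "m > 0" "(real m)\<^sup>2 \<le> 4 * p"
    and small: "4 * m * A < r" "real m * A < p + (real m)\<^sup>2 / 4"
  shows "real m * (real A + sp) \<notin> sums_of_squares (ring_of_integers K)"
proof
  assume "real m * (real A + sp) \<in> sums_of_squares (ring_of_integers K)"
  then obtain xs where xs: "set xs \<subseteq> ring_of_integers K"
    and sum: "real m * (real A + sp) = (\<Sum>x\<leftarrow>xs. x\<^sup>2)"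
    unfolding sums_of_squares_def by auto
  have "\<exists>a b c d. a \<in> \<rat> \<and> b \<in> \<rat> \<and> c \<in> \<rat> \<and> d \<in> \<rat> \<and> x = comb a b c d" if "x \<in> set xs" for x
  proof -
    have "x \<in> K" using that xs unfolding ring_of_integers_def by auto
    then show ?thesis by (rule field_element_coords) blast
  qed
  then obtain a b c d where rat: "\<And>x. x \<in> set xs \<Longrightarrow> a x \<in> \<rat>" "\<And>x. x \<in> set xs \<Longrightarrow> b x \<in> \<rat>"
      "\<And>x. x \<in> set xs \<Longrightarrow> c x \<in> \<rat>" "\<And>x. x \<in> set xs \<Longrightarrow> d x \<in> \<rat>"
    and x: "\<And>x. x \<in> set xs \<Longrightarrow> x = comb (a x) (b x) (c x) (d x)"
    by metis
  have int: "algebraic_int (comb (a x) (b x) (c x) (d x))" if "x \<in> set xs" for x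
    using that xs x[OF that] unfolding ring_of_integers_def by auto
  define R where "R x = (a x)\<^sup>2 + p * (b x)\<^sup>2 + q * (c x)\<^sup>2 + r * (d x)\<^sup>2" for x
  define S where "S x = 2 * (a x * b x + q0 * c x * d x)" for x
  define T where "T x = 2 * (a x * c x + p0 * b x * d x)" for x
  define U where "U x = 2 * (a x * d x + g * b x * c x)" for x
  have "comb (real m * A) m 0 0 = real m * (real A + sp)"
    by (simp add: comb_def algebra_simps)
  also have "map (\<lambda>x. x\<^sup>2) xs = map (\<lambda>x. comb (R x) (S x) (T x) (U x)) xs"
    using x by (intro map_cong refl) (metis R_def S_def T_def U_def comb_square)
  then have "real m * (real A + sp) = comb (\<Sum>x\<leftarrow>xs. R x) (\<Sum>x\<leftarrow>xs. S x) (\<Sum>x\<leftarrow>xs. T x) (\<Sum>x\<leftarrow>xs. U x)"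
    by (simp only: sum sum_list_comb)
  finally have eq: "comb (real m * A) m 0 0 = \<dots>" .
  have sums_rat: "(\<Sum>x\<leftarrow>xs. R x) \<in> \<rat>" "(\<Sum>x\<leftarrow>xs. S x) \<in> \<rat>" "(\<Sum>x\<leftarrow>xs. T x) \<in> \<rat>" "(\<Sum>x\<leftarrow>xs. U x) \<in> \<rat>"
    using rat by (auto intro!: sum_list_Rats simp: R_def S_def T_def U_def)
  have R: "(\<Sum>x\<leftarrow>xs. R x) = real m * A"
    using comb_inject(1)[OF _ _ _ _ sums_rat eq] by simp
  have S: "(\<Sum>x\<leftarrow>xs. S x) = m"
    using comb_inject(2)[OF _ _ _ _ sums_rat eq] by simp
  \<comment> \<open>A nonzero half-integer \<open>d x\<close> has square at least 1/4, so its
    summand alone would contribute \<open>r / 4\<close> to the rational part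
    \<open>m A\<close>.\<close>
  have d0: "d x = 0" if "x \<in> set xs" for x
  proof (rule ccontr)
    assume "d x \<noteq> 0"
    have "2 * d x \<in> \<int>" using integer_coords(4)[OF rat[OF that] int[OF that]] .
    then have "1 \<le> \<bar>2 * d x\<bar>" using \<open>d x \<noteq> 0\<close> by (intro Ints_nonzero_abs_ge1) auto
    then have "1 \<le> \<bar>2 * d x\<bar>\<^sup>2" by (rule one_le_power)
    then have "real r * 1 \<le> real r * (4 * (d x)\<^sup>2)" by (intro mult_left_mono) auto
    also have "\<dots> \<le> 4 * R x" by (simp add: R_def)
    also have "R x \<le> (\<Sum>x\<leftarrow>xs. R x)"
      by (rule member_le_sum_list_nonneg) (use that in \<open>auto simp: R_def\<close>)
    finally have "real r \<le> 4 * (real m * A)" using R by simp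
    then have "real r \<le> real (4 * m * A)" by simp
    then show False using small(1) by linarith
  qed
  have bint: "b x \<in> \<int>" if "x \<in> set xs" for x
    using integer_second_coord[OF rat(1-3)[OF that]] int[OF that] d0[OF that] by simp
  \<comment> \<open>With \<open>d x = 0\<close> the cross term \<open>q0 c d\<close> disappears from
    the coefficient of sqrt p.\<close>
  have "map S xs = map (\<lambda>x. 2 * (a x * b x)) xs" using d0 by (simp add: S_def)
  then have "(\<Sum>x\<leftarrow>xs. 2 * (a x * b x)) = real m" using S by (simp only:)
  from sum_list_weighted_squares_ge[OF bint this] m
  have "p + (real m)\<^sup>2 / 4 \<le> (\<Sum>x\<leftarrow>xs. (a x)\<^sup>2 + p * (b x)\<^sup>2)" by simp
  also have "\<dots> \<le> (\<Sum>x\<leftarrow>xs. R x)" by (rule sum_list_mono) (simp add: R_def)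
  finally show False using small(2) R by simp
qed

section \<open>Total positivity of \<open>A + sqrt p\<close>\<close>

lemma of_nat_mem_field: "real n \<in> K"
  unfolding biquadratic_field_def by (rule subfield_of.of_nat_mem[OF subfield_of_gen_subfield])

lemma real_embedding_of_nat:
  assumes "real_embedding K \<sigma>"
  shows "\<sigma> (real n) = real n"
proof (induction n)
  case 0
  have "\<sigma> (real 0 + real 0) = \<sigma> (real 0) + \<sigma> (real 0)"
    using assms of_nat_mem_field unfolding real_embedding_def by blast
  then show ?case by simp
next
  case (Suc n)
  have "\<sigma> (real n + real 1) = \<sigma> (real n) + \<sigma> (real 1)"
    using assms of_nat_mem_field unfolding real_embedding_def by blast
  then show ?case using Suc assms by (simp add: real_embedding_def add.commute)
qed

text \<open>From \<open>\<sigma> sp * \<sigma> sp = p\<close> every real embedding sends sqrt p to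
  plus or minus sqrt p, so the image is at least \<open>A - sqrt p > 0\<close>; the embeddings are
  never enumerated.\<close>

lemma totally_positive_integer:
  assumes "sp < real A"
  shows "real A + sp \<in> totally_positive_integers K"
proof -
  have sp: "sp \<in> K" unfolding biquadratic_field_def by (auto intro: gen_subfield.gen)
  have "\<sigma> (real A + sp) > 0" if \<sigma>: "real_embedding K \<sigma>" for \<sigma>
  proof -
    have "\<sigma> sp * \<sigma> sp = \<sigma> (sp * sp)" using \<sigma> sp unfolding real_embedding_def by metis
    then have "(\<sigma> sp)\<^sup>2 = real p"
      using real_embedding_of_nat[OF \<sigma>, of p] by (simp add: power2_eq_square)
    then have "\<bar>\<sigma> sp\<bar> = sp" by (metis real_sqrt_abs)
    moreover have "\<sigma> (real A + sp) = real A + \<sigma> sp"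
      using \<sigma> sp of_nat_mem_field[of A] real_embedding_of_nat[OF \<sigma>, of A] unfolding real_embedding_def by simp
    ultimately show ?thesis using assms by linarith
  qed
  moreover have "real A + sp \<in> K"
    using of_nat_mem_field[of A] sp unfolding biquadratic_field_def by (rule gen_subfield.add)
  moreover have "algebraic_int (real A + sp)"
    by (intro algebraic_int_plus algebraic_int_sqrt int_imp_algebraic_int) auto
  ultimately show ?thesis
    by (simp add: totally_positive_integers_def totally_positive_def ring_of_integers_def)
qed

end

text \<open>Taking roots gives \<open>sqrt (2 M N) \<le> sqrt P - M\<close>. Nonnegativity of the
  left side yields the first bound, squaring the second.\<close>

lemma quadratic_bound_of_sqrt_bound:
  fixes P M N :: real
  assumes "0 \<le> M" "0 \<le> N" "0 \<le> P" "(M + sqrt (2 * M * N))\<^sup>2 \<le> P"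
  shows "M\<^sup>2 \<le> P" "2 * M * (sqrt P + N) \<le> P + M\<^sup>2"
proof -
  have root: "M + sqrt (2 * M * N) \<le> sqrt P" using assms(4) by (rule real_le_rsqrt)
  have nn: "0 \<le> sqrt (2 * M * N)" using assms by simp
  have "M \<le> sqrt P" using root nn by linarith
  then have "M\<^sup>2 \<le> (sqrt P)\<^sup>2" using assms(1) by (rule power_mono)
  then show "M\<^sup>2 \<le> P" using assms(3) by simp
  have "(sqrt (2 * M * N))\<^sup>2 \<le> (sqrt P - M)\<^sup>2"
    using root nn by (intro power_mono) auto
  then show "2 * M * (sqrt P + N) \<le> P + M\<^sup>2"
    using assms by (simp add: power2_diff algebra_simps)
qed

theorem theorem2:
  fixes p q r m :: nat and K :: "real set" and N1 N2 :: real
  assumes "squarefree p" and "squarefree q" and "p \<ge> 2" and "q \<ge> 2"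
    and "p mod 4 = 2" and "q mod 4 = 3"
    and "r = p * q div (gcd p q)\<^sup>2"
    and "p < q" and "q < r"
    and "K = biquadratic_field p q"
    and "m > 0"
    and "\<exists>\<kappa>::nat. \<kappa> > 0 \<and>
           real m < real r / (16 * real \<kappa> * real_of_int \<lceil>sqrt (real r)\<rceil>)"
    and "N1 = real_of_int (max \<lceil>2 * sqrt (real q) - sqrt (real p)\<rceil>
                               \<lceil>sqrt (real r) - sqrt (real p)\<rceil>) - sqrt (real p)"
    and "N2 = real_of_int (max \<lceil>2 * sqrt (real p) - sqrt (real q)\<rceil>
                               \<lceil>sqrt (real r) - sqrt (real q)\<rceil>) - sqrt (real q)"
    and "N1 \<ge> 0" and "N2 \<ge> 0"
    and "real p \<ge> (real m + sqrt (2 * real m * N1))\<^sup>2"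
    and "real q \<ge> (real m + sqrt (2 * real m * N2))\<^sup>2"
  shows "\<not> (\<forall>\<alpha> \<in> (\<lambda>\<alpha>. of_nat m * \<alpha>) ` totally_positive_integers K.
              \<alpha> \<in> sums_of_squares (ring_of_integers K))"
proof -
  define g where "g = gcd p q"
  have "g > 0" using assms(3) by (simp add: g_def)
  obtain p0 q0 where pq: "p = g * p0" "q = g * q0" "coprime p0 q0"
    using gcd_coprime_exists[of p q] \<open>g > 0\<close> unfolding g_def by (auto simp: mult.commute)
  have "p * q = p0 * q0 * g\<^sup>2" by (simp add: pq power2_eq_square)
  then have "r = p0 * q0" using assms(7) \<open>g > 0\<close> unfolding g_def[symmetric] by simp
  then interpret biquadratic p q r g p0 q0
    by unfold_locales (use pq assms(1,2,5,6) in auto)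
  define k where "k = max \<lceil>2 * sqrt q - sqrt p\<rceil> \<lceil>sqrt r - sqrt p\<rceil>"
  define A where "A = nat k"
  have N1: "N1 = real_of_int k - sqrt p" using assms(13) by (simp add: k_def)
  then have "sqrt p \<le> of_int k" using assms(15) by simp
  \<comment> \<open>The hypothesis \<open>N1 \<ge> 0\<close> gives only a weak inequality;
    irrationality makes it strict, as total positivity requires.\<close>
  moreover have "sqrt p \<noteq> of_int k" using irrational(1) by (metis Rats_of_int)
  ultimately have lt: "sqrt p < of_int k" by simp
  moreover have "0 \<le> sqrt p" by simp
  ultimately have "0 < real_of_int k" by linarith
  then have A: "real A = of_int k" by (simp add: A_def)
  \<comment> \<open>Here sqrt p + \<open>N1\<close> is exactly \<open>A\<close>.\<close>
  have bounds: "(real m)\<^sup>2 \<le> p" "2 * real m * A \<le> p + (real m)\<^sup>2"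
    using quadratic_bound_of_sqrt_bound[of "real m" N1 p] assms(15,17) by (auto simp: N1 A)
  \<comment> \<open>Halving the second bound gives \<open>m A \<le> p/2 + m^2/2\<close>, and
    \<open>m^2/4 < p/2\<close> follows from \<open>0 < m^2 \<le> p\<close>.\<close>
  have "0 < (real m)\<^sup>2" using assms(11) by simp
  then have "real m * A < p + (real m)\<^sup>2 / 4"
    using bounds by (simp only: mult.assoc)
  define R where "R = \<lceil>sqrt r\<rceil>"
  have R: "sqrt r \<le> of_int R" by (simp add: R_def le_of_int_ceiling)
  have Rpos: "R > 0" using R ge_2(3) by (simp add: R_def)
  have "sqrt q \<le> sqrt r" using assms(9) by simp
  moreover have "0 \<le> sqrt p" "0 < real_of_int R" using Rpos by auto
  \<comment> \<open>Since sqrt q and sqrt r are at most \<open>R\<close>, both candidates in the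
    maximum are at most \<open>2 * R\<close>.\<close>
  ultimately have "2 * sqrt q - sqrt p \<le> 2 * real_of_int R" "sqrt r - sqrt p \<le> 2 * real_of_int R"
    using R by linarith+
  then have "k \<le> 2 * R" unfolding k_def by (simp add: ceiling_le_iff)
  obtain \<kappa> :: nat where \<kappa>: "\<kappa> > 0" "real m < real r / (16 * real \<kappa> * R)"
    using assms(12) unfolding R_def by blast
  then have "real m * (16 * real \<kappa> * R) < r" using Rpos by (simp add: pos_less_divide_eq)
  \<comment> \<open>As \<open>\<kappa> \<ge> 1\<close>, it may be replaced by 1; then
    \<open>A \<le> 2 R\<close> gives \<open>4 m A \<le> 8 m R \<le> 16 m R < r\<close>.\<close>
  moreover have "real m * (16 * 1 * R) \<le> real m * (16 * real \<kappa> * R)"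
    using \<kappa>(1) Rpos by (intro mult_left_mono mult_right_mono) auto
  moreover have "real m * (4 * real A) \<le> real m * (16 * 1 * R)"
    using \<open>k \<le> 2 * R\<close> Rpos by (intro mult_left_mono) (auto simp: A)
  ultimately have "real m * (4 * real A) < r" by linarith
  then have "real (4 * m * A) < r" by (simp add: mult_ac)
  then have "4 * m * A < r" by linarith
  then have "real m * (real A + sqrt p) \<notin> sums_of_squares (ring_of_integers K)"
    using not_sum_of_squares[of m A] \<open>real m * A < p + (real m)\<^sup>2 / 4\<close> assms(10,11) bounds(1) by simp
  moreover have "real A + sqrt p \<in> totally_positive_integers K"
    using totally_positive_integer[of A] lt A assms(10) by simp
  ultimately show ?thesis by blast
qed

end
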